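(* The group $Iso(Iso(\mathbb{Z}))$ is Cauchy-indivisible (that is, the evaluation action $(Iso(Iso(\mathbb{Z})),Iso(\mathbb{Z}))$ is Cauchy-indivisible) and has no Weil completion.
   Context: For a metric space $Y$, $Iso(Y)$ is the group of surjective isometries of $Y$ with the topology of pointwise convergence. $\mathbb Z$ carries the discrete metric $d$ ($d(m,n)=0$ if $m=n$, and $1$ otherwise), so $Iso(\mathbb Z)$ is the group of all bijections of $\mathbb Z$. Fix an enumeration $\{z_i\}_{i\ge1}$ of $\mathbb Z$ and equip $Iso(\mathbb Z)$ with the metric $$\varrho(f,g)=\sum_{i=1}^\infty\frac1{3^i}\,d(fz_i,gz_i).$$ $Iso(Iso(\mathbb Z))$ is the group of surjective isometries of $(Iso(\mathbb Z),\varrho)$. "$g_i\to\infty$ in $G$" means that the net $\{g_i\}$ has no convergent subnet in $G$. An action $(G,Y)$ on a metric space $Y$ is Cauchy-indivisible if: whenever $\{g_i\}$ is a net in $G$ with $g_i\to\infty$ in $G$ and $\{g_iy\}$ is a Cauchy net for some $y\in Y$, then $\{g_iy\}$ is a Cauchy net for every $y\in Y$. A topological group has a Weil completion (with respect to the uniformity of pointwise convergence, which for the groups $Iso(Y)$ coincides with the left uniformity) if it can be embedded densely, as a topological group, in a topological group that is complete with respect to its left uniform structure. *)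

theory Defs
  imports "HOL-Analysis.Analysis" "HOL-Algebra.Group_Action"
begin

section \<open>Nets\<close>

definition directed_set :: "'i set \<Rightarrow> ('i \<Rightarrow> 'i \<Rightarrow> bool) \<Rightarrow> bool" where
  "directed_set I leI \<longleftrightarrow>
     I \<noteq> {} \<and>
     (\<forall>i\<in>I. leI i i) \<and>
     (\<forall>i\<in>I. \<forall>j\<in>I. \<forall>k\<in>I. leI i j \<longrightarrow> leI j k \<longrightarrow> leI i k) \<and>
     (\<forall>i\<in>I. \<forall>j\<in>I. \<exists>k\<in>I. leI i k \<and> leI j k)"

definition net_converges ::
  "'a topology \<Rightarrow> 'i set \<Rightarrow> ('i \<Rightarrow> 'i \<Rightarrow> bool) \<Rightarrow> ('i \<Rightarrow> 'a) \<Rightarrow> 'a \<Rightarrow> bool" where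
  "net_converges T I leI g x \<longleftrightarrow>
     x \<in> topspace T \<and>
     (\<forall>U. openin T U \<and> x \<in> U \<longrightarrow> (\<exists>i0\<in>I. \<forall>i\<in>I. leI i0 i \<longrightarrow> g i \<in> U))"

definition cauchy_net ::
  "('a \<Rightarrow> 'a \<Rightarrow> real) \<Rightarrow> 'i set \<Rightarrow> ('i \<Rightarrow> 'i \<Rightarrow> bool) \<Rightarrow> ('i \<Rightarrow> 'a) \<Rightarrow> bool" where
  "cauchy_net d I leI u \<longleftrightarrow>
     (\<forall>\<epsilon>>0. \<exists>i0\<in>I. \<forall>i\<in>I. \<forall>j\<in>I. leI i0 i \<longrightarrow> leI i0 j \<longrightarrow> d (u i) (u j) < \<epsilon>)"

text \<open>The net \<open>g \<circ> \<phi>\<close>, indexed by \<open>J\<close>, is then a subnet of \<open>g\<close>.\<close>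

definition subnet_map ::
  "'j set \<Rightarrow> ('j \<Rightarrow> 'j \<Rightarrow> bool) \<Rightarrow> 'i set \<Rightarrow> ('i \<Rightarrow> 'i \<Rightarrow> bool) \<Rightarrow> ('j \<Rightarrow> 'i) \<Rightarrow> bool" where
  "subnet_map J leJ I leI \<phi> \<longleftrightarrow>
     \<phi> \<in> J \<rightarrow> I \<and> (\<forall>i\<in>I. \<exists>j0\<in>J. \<forall>j\<in>J. leJ j0 j \<longrightarrow> leI i (\<phi> j))"

text \<open>
  A quantifier over the index set of a subnet has to range over one type.  Index sets in
  \<open>'i \<times> 'a set\<close> (pairs of an index and a neighbourhood of the limit) are enough: the lemma
  \<open>net_to_infinity_no_subnet\<close> below shows that a net satisfying this definition has no convergent
  subnet over a directed set of any type whatsoever.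
\<close>

definition net_to_infinity ::
  "'a topology \<Rightarrow> 'i set \<Rightarrow> ('i \<Rightarrow> 'i \<Rightarrow> bool) \<Rightarrow> ('i \<Rightarrow> 'a) \<Rightarrow> bool" where
  "net_to_infinity T I leI g \<longleftrightarrow>
     \<not> (\<exists>(J :: ('i \<times> 'a set) set) leJ \<phi> x.
          directed_set J leJ \<and> subnet_map J leJ I leI \<phi> \<and> net_converges T J leJ (g \<circ> \<phi>) x)"

lemma net_to_infinity_no_subnet:
  fixes g :: "'i \<Rightarrow> 'a" and J :: "'j set"
  assumes inf: "net_to_infinity T I leI g" and I: "directed_set I leI"
    and J: "directed_set J leJ" and sub: "subnet_map J leJ I leI \<phi>"
  shows "\<not> net_converges T J leJ (g \<circ> \<phi>) x"
proof
  assume conv: "net_converges T J leJ (g \<circ> \<phi>) x"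
  define K where "K = {(i, U). i \<in> I \<and> openin T U \<and> x \<in> U \<and> g i \<in> U}"
  define leK where "leK = (\<lambda>p q. leI (fst p) (fst q) \<and> (snd q :: 'a set) \<subseteq> snd p)"
  have x: "x \<in> topspace T" using conv by (simp add: net_converges_def)
  have cluster: "\<exists>k\<in>I. leI i k \<and> g k \<in> U" if i: "i \<in> I" and U: "openin T U" "x \<in> U" for i U
  proof -
    obtain j1 where j1: "j1 \<in> J" "\<And>j. j \<in> J \<Longrightarrow> leJ j1 j \<Longrightarrow> leI i (\<phi> j)"
      using sub i unfolding subnet_map_def by blast
    obtain j2 where j2: "j2 \<in> J" "\<And>j. j \<in> J \<Longrightarrow> leJ j2 j \<Longrightarrow> (g \<circ> \<phi>) j \<in> U"
      using conv U unfolding net_converges_def by blast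
    obtain j where j: "j \<in> J" "leJ j1 j" "leJ j2 j"
      using J j1(1) j2(1) unfolding directed_set_def by blast
    have "\<phi> j \<in> I" using sub j(1) by (auto simp: subnet_map_def)
    then show ?thesis using j1(2) j2(2) j by auto
  qed
  have Itrans: "leI i k" if "leI i j" "leI j k" "i \<in> I" "j \<in> I" "k \<in> I" for i j k
    using I that unfolding directed_set_def by blast
  have Irefl: "leI i i" if "i \<in> I" for i
    using I that unfolding directed_set_def by blast
  obtain i0 where i0: "i0 \<in> I" using I by (auto simp: directed_set_def)
  have K: "\<exists>k\<in>I. leI i k \<and> (k, U) \<in> K" if "i \<in> I" "openin T U" "x \<in> U" for i U
    using cluster[OF that] that by (auto simp: K_def)
  have dirK: "directed_set K leK"
    unfolding directed_set_def
  proof (intro conjI ballI impI)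
    show "K \<noteq> {}" using K[OF i0 openin_topspace x] by auto
    show "leK p p" if "p \<in> K" for p
      using that Irefl by (auto simp: K_def leK_def)
    show "leK p r" if "p \<in> K" "q \<in> K" "r \<in> K" "leK p q" "leK q r" for p q r
      using that Itrans by (fastforce simp: K_def leK_def)
    show "\<exists>r\<in>K. leK p r \<and> leK q r" if pq: "p \<in> K" "q \<in> K" for p q
    proof -
      obtain i U j V where p: "p = (i, U)" and q: "q = (j, V)" by fastforce
      have ij: "i \<in> I" "j \<in> I" and UV: "openin T (U \<inter> V)" "x \<in> U \<inter> V"
        using pq unfolding p q by (auto simp: K_def)
      obtain m where m: "m \<in> I" "leI i m" "leI j m"
        using I ij unfolding directed_set_def by blast
      obtain k where k: "k \<in> I" "leI m k" "(k, U \<inter> V) \<in> K"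
        using K[OF m(1) UV] by blast
      have "leI i k" "leI j k" using Itrans m k ij by blast+
      then show ?thesis
        using k by (intro bexI[of _ "(k, U \<inter> V)"]) (auto simp: leK_def p q)
    qed
  qed
  have subK: "subnet_map K leK I leI fst"
    unfolding subnet_map_def
  proof (intro conjI ballI)
    show "fst \<in> K \<rightarrow> I" by (auto simp: K_def)
    fix i assume i: "i \<in> I"
    obtain k where k: "k \<in> I" "leI i k" "(k, topspace T) \<in> K"
      using K[OF i openin_topspace x] by blast
    show "\<exists>p\<in>K. \<forall>q\<in>K. leK p q \<longrightarrow> leI i (fst q)"
    proof (intro bexI[of _ "(k, topspace T)"] ballI impI)
      fix q assume "q \<in> K" "leK (k, topspace T) q"
      then show "leI i (fst q)"
        using Itrans[OF k(2) _ i k(1), of "fst q"] by (auto simp: leK_def K_def)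
    qed (fact k(3))
  qed
  have "net_converges T K leK (g \<circ> fst) x"
    unfolding net_converges_def
  proof (intro conjI allI impI x)
    fix U assume U: "openin T U \<and> x \<in> U"
    obtain k where k: "k \<in> I" "(k, U) \<in> K" using K[OF i0] U by blast
    show "\<exists>p\<in>K. \<forall>q\<in>K. leK p q \<longrightarrow> (g \<circ> fst) q \<in> U"
    proof (intro bexI[of _ "(k, U)"] ballI impI)
      fix q assume "q \<in> K" "leK (k, U) q"
      then show "(g \<circ> fst) q \<in> U" by (auto simp: leK_def K_def)
    qed (fact k(2))
  qed
  then show False
    using inf dirK subK unfolding net_to_infinity_def by blast
qed


section \<open>Topological groups and Weil completions\<close>

locale top_group = group G for G :: "('g, 'b) monoid_scheme" (structure) +
  fixes T :: "'g topology"
  assumes topspace_eq: "topspace T = carrier G"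
    and continuous_mult: "continuous_map (prod_topology T T) T (\<lambda>(x, y). x \<otimes> y)"
    and continuous_inv: "continuous_map T T (\<lambda>x. inv x)"

definition left_uniformity :: "('g, 'b) monoid_scheme \<Rightarrow> 'g topology \<Rightarrow> ('g \<times> 'g) filter" where
  "left_uniformity G T =
     (INF U\<in>{U. openin T U \<and> \<one>\<^bsub>G\<^esub> \<in> U}.
        principal {(x, y). x \<in> carrier G \<and> y \<in> carrier G \<and> inv\<^bsub>G\<^esub> x \<otimes>\<^bsub>G\<^esub> y \<in> U})"

definition left_complete :: "('g, 'b) monoid_scheme \<Rightarrow> 'g topology \<Rightarrow> bool" where
  "left_complete G T \<longleftrightarrow>
     (\<forall>F. F \<noteq> bot \<longrightarrow> F \<le> principal (carrier G) \<longrightarrow> F \<times>\<^sub>F F \<le> left_uniformity G T \<longrightarrow>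
        (\<exists>x\<in>carrier G. limitin T (\<lambda>y. y) x F))"

text \<open>
  The argument of type \<open>'h itself\<close> is the type in which the elements of the completion live;
  the absence of a Weil completion is stated for an arbitrary type \<open>'h\<close>.
  The completion is not required to be Hausdorff.
\<close>

definition has_Weil_completion ::
  "'h itself \<Rightarrow> ('g, 'b) monoid_scheme \<Rightarrow> 'g topology \<Rightarrow> bool" where
  "has_Weil_completion _ G T \<longleftrightarrow>
     (\<exists>(H :: 'h monoid) S \<phi>.
        top_group H S \<and> left_complete H S \<and>
        \<phi> \<in> hom G H \<and> embedding_map T S \<phi> \<and> S closure_of (\<phi> ` carrier G) = carrier H)"


section \<open>Isometry groups and Cauchy-indivisible actions\<close>

text \<open>As for \<open>Bij\<close>, maps are normalised to be \<open>undefined\<close> outside \<open>M\<close>.\<close>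

definition isometries :: "'a set \<Rightarrow> ('a \<Rightarrow> 'a \<Rightarrow> real) \<Rightarrow> ('a \<Rightarrow> 'a) set" where
  "isometries M d = {f \<in> extensional M. f ` M = M \<and> (\<forall>x\<in>M. \<forall>y\<in>M. d (f x) (f y) = d x y)}"

definition Iso :: "'a set \<Rightarrow> ('a \<Rightarrow> 'a \<Rightarrow> real) \<Rightarrow> ('a \<Rightarrow> 'a) monoid" where
  "Iso M d = \<lparr>carrier = isometries M d, mult = compose M, one = (\<lambda>x\<in>M. x)\<rparr>"

definition pointwise_topology :: "'a set \<Rightarrow> ('a \<Rightarrow> 'a \<Rightarrow> real) \<Rightarrow> ('a \<Rightarrow> 'a) topology" where
  "pointwise_topology M d =
     subtopology (product_topology (\<lambda>_. Metric_space.mtopology M d) M) (isometries M d)"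

text \<open>
  The index sets of the nets are the directed subsets of the type \<open>'i\<close>; Cauchy-indivisibility is
  this property for an arbitrary type \<open>'i\<close>.
\<close>

definition Cauchy_indivisible ::
  "'i itself \<Rightarrow> ('g, 'b) monoid_scheme \<Rightarrow> 'g topology \<Rightarrow> ('g \<Rightarrow> 'y \<Rightarrow> 'y)
     \<Rightarrow> 'y set \<Rightarrow> ('y \<Rightarrow> 'y \<Rightarrow> real) \<Rightarrow> bool" where
  "Cauchy_indivisible _ G T act Y d \<longleftrightarrow>
     (\<forall>(I :: 'i set) leI g.
        directed_set I leI \<longrightarrow> g \<in> I \<rightarrow> carrier G \<longrightarrow> net_to_infinity T I leI g \<longrightarrow>
        (\<exists>y\<in>Y. cauchy_net d I leI (\<lambda>i. act (g i) y)) \<longrightarrow>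
        (\<forall>y\<in>Y. cauchy_net d I leI (\<lambda>i. act (g i) y)))"

context Metric_space
begin

lemma isometries_subset_Bij: "isometries M d \<subseteq> Bij M"
proof
  fix f assume f: "f \<in> isometries M d"
  have "inj_on f M"
  proof (rule inj_onI)
    fix x y assume xy: "x \<in> M" "y \<in> M" "f x = f y"
    have "f y \<in> M" "d (f x) (f y) = d x y" using f xy(1,2) by (auto simp: isometries_def)
    then have "d x y = 0" using xy(3) by simp
    then show "x = y" using xy(1,2) by simp
  qed
  then show "f \<in> Bij M"
    using f by (auto simp: isometries_def Bij_def bij_betw_def)
qed

lemma isometries_memD:
  assumes "f \<in> isometries M d"
  shows "x \<in> M \<Longrightarrow> f x \<in> M" "x \<in> M \<Longrightarrow> y \<in> M \<Longrightarrow> d (f x) (f y) = d x y"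
  using assms by (auto simp: isometries_def)

lemma restrict_inv_isometries:
  assumes f: "f \<in> isometries M d"
  shows "restrict (inv_into M f) M \<in> isometries M d"
proof -
  have "restrict (inv_into M f) M \<in> Bij M"
    using f isometries_subset_Bij restrict_inv_into_Bij by blast
  moreover have "d (inv_into M f x) (inv_into M f y) = d x y" if "x \<in> M" "y \<in> M" for x y
  proof -
    have fM: "f ` M = M" using f by (simp add: isometries_def)
    then have "inv_into M f x \<in> M" "inv_into M f y \<in> M"
      using that by (metis inv_into_into)+
    then have "d (f (inv_into M f x)) (f (inv_into M f y)) = d (inv_into M f x) (inv_into M f y)"
      using isometries_memD(2)[OF f] by blast
    then show ?thesis using that fM by (simp add: f_inv_into_f)
  qed
  ultimately show ?thesis
    by (simp add: isometries_def Bij_def bij_betw_def)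
qed

lemma compose_isometries:
  assumes "f \<in> isometries M d" "g \<in> isometries M d"
  shows "compose M f g \<in> isometries M d"
proof -
  have "compose M f g \<in> Bij M"
    using assms isometries_subset_Bij compose_Bij by blast
  moreover have "d (f (g x)) (f (g y)) = d x y" if "x \<in> M" "y \<in> M" for x y
    using that isometries_memD(2)[OF assms(1)] isometries_memD[OF assms(2)] by presburger
  ultimately show ?thesis
    by (simp add: isometries_def Bij_def bij_betw_def compose_eq)
qed

lemma group_Iso: "group (Iso M d)"
proof (rule groupI)
  show "\<one>\<^bsub>Iso M d\<^esub> \<in> carrier (Iso M d)"
    by (auto simp: Iso_def isometries_def)
  show "\<exists>g\<in>carrier (Iso M d). g \<otimes>\<^bsub>Iso M d\<^esub> f = \<one>\<^bsub>Iso M d\<^esub>" if "f \<in> carrier (Iso M d)" for f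
    using that restrict_inv_isometries Bij_compose_restrict_eq isometries_subset_Bij
    by (fastforce simp: Iso_def)
  show "\<one>\<^bsub>Iso M d\<^esub> \<otimes>\<^bsub>Iso M d\<^esub> f = f" if "f \<in> carrier (Iso M d)" for f
  proof -
    have "f \<in> Bij M" using that isometries_subset_Bij by (auto simp: Iso_def)
    then show ?thesis
      by (simp add: Iso_def Bij_imp_funcset Bij_imp_extensional)
  qed
  show "f \<otimes>\<^bsub>Iso M d\<^esub> g \<otimes>\<^bsub>Iso M d\<^esub> h = f \<otimes>\<^bsub>Iso M d\<^esub> (g \<otimes>\<^bsub>Iso M d\<^esub> h)"
    if "f \<in> carrier (Iso M d)" "g \<in> carrier (Iso M d)" "h \<in> carrier (Iso M d)" for f g h
  proof -
    have "h \<in> M \<rightarrow> M" using that isometries_memD(1)[of h] by (auto simp: Iso_def)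
    then show ?thesis by (simp add: Iso_def compose_assoc)
  qed
qed (simp add: Iso_def compose_isometries)

lemma inv_Iso:
  assumes "f \<in> isometries M d"
  shows "inv\<^bsub>Iso M d\<^esub> f = restrict (inv_into M f) M"
proof -
  interpret group "Iso M d" by (rule group_Iso)
  show ?thesis
    using assms restrict_inv_isometries Bij_compose_restrict_eq isometries_subset_Bij
    by (intro inv_equality) (auto simp: Iso_def)
qed

lemma topspace_pointwise_topology [simp]: "topspace (pointwise_topology M d) = isometries M d"
proof -
  have "isometries M d \<subseteq> (\<Pi>\<^sub>E x\<in>M. M)"
    by (auto simp: PiE_iff isometries_def extensional_def)
  then show ?thesis by (auto simp: pointwise_topology_def)
qed

lemma continuous_map_pointwise_topology:
  "continuous_map X (pointwise_topology M d) h \<longleftrightarrow>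
     h \<in> topspace X \<rightarrow> isometries M d \<and> (\<forall>x\<in>M. continuous_map X mtopology (\<lambda>t. h t x))"
  by (auto simp: pointwise_topology_def continuous_map_in_subtopology
      continuous_map_componentwise isometries_def)

lemma openin_pointwise_ball:
  assumes "x \<in> M" "f0 \<in> isometries M d"
  shows "openin (pointwise_topology M d) {f \<in> isometries M d. d (f0 x) (f x) < e}"
proof -
  have "continuous_map (pointwise_topology M d) mtopology (\<lambda>f. f x)"
    using continuous_map_pointwise_topology[of "pointwise_topology M d" "\<lambda>f. f"] assms(1)
      continuous_map_id[of "pointwise_topology M d", unfolded id_def] by blast
  then have "openin (pointwise_topology M d)
      {f \<in> topspace (pointwise_topology M d). f x \<in> mball (f0 x) e}"
    using openin_continuous_map_preimage openin_mball by blast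
  moreover have "{f \<in> topspace (pointwise_topology M d). f x \<in> mball (f0 x) e}
      = {f \<in> isometries M d. d (f0 x) (f x) < e}"
    using assms by (auto simp: isometries_def)
  ultimately show ?thesis by simp
qed

proposition top_group_Iso: "top_group (Iso M d) (pointwise_topology M d)"
proof -
  interpret group "Iso M d" by (rule group_Iso)
  let ?T = "pointwise_topology M d" and ?B = "\<lambda>f0 x e. {f \<in> isometries M d. d (f0 x) (f x) < e}"
  have "continuous_map (prod_topology ?T ?T) ?T (\<lambda>p. compose M (fst p) (snd p))"
    unfolding continuous_map_pointwise_topology continuous_map_to_metric
  proof (intro conjI ballI allI impI)
    show "(\<lambda>p. compose M (fst p) (snd p)) \<in> topspace (prod_topology ?T ?T) \<rightarrow> isometries M d"
      by (auto simp: compose_isometries)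
    fix x p and e :: real
    assume x: "x \<in> M" and p: "p \<in> topspace (prod_topology ?T ?T)" and e: "0 < e"
    obtain f0 g0 where fg: "p = (f0, g0)" "f0 \<in> isometries M d" "g0 \<in> isometries M d"
      using p by auto
    let ?U = "?B f0 (g0 x) (e/2) \<times> ?B g0 x (e/2)"
    have gx: "g0 x \<in> M" using fg x isometries_memD by blast
    have f0M: "f0 (g0 x) \<in> M" using fg gx isometries_memD by blast
    have "openin (prod_topology ?T ?T) ?U"
      using openin_pointwise_ball[OF gx fg(2)] openin_pointwise_ball[OF x fg(3)]
      by (simp only: openin_prod_Times_iff simp_thms)
    moreover have "p \<in> ?U" using fg e gx f0M by simp
    moreover have "compose M (fst q) (snd q) x \<in> mball (compose M (fst p) (snd p) x) e"
      if q: "q \<in> ?U" for q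
    proof -
      obtain f g where fg': "q = (f, g)" "f \<in> isometries M d" "g \<in> isometries M d"
        and ds: "d (f0 (g0 x)) (f (g0 x)) < e/2" "d (g0 x) (g x) < e/2"
        using q by auto
      have gx': "g x \<in> M" "f (g0 x) \<in> M" "f (g x) \<in> M"
        using fg' x gx isometries_memD(1) by blast+
      have "d (f (g0 x)) (f (g x)) = d (g0 x) (g x)"
        using isometries_memD(2)[OF fg'(2)] gx gx' by blast
      then have "d (f0 (g0 x)) (f (g x)) < e"
        using triangle[OF f0M gx'(2) gx'(3)] ds by linarith
      then show ?thesis using fg fg' f0M gx' x by (simp add: compose_eq)
    qed
    ultimately show "\<exists>U. openin (prod_topology ?T ?T) U \<and> p \<in> U \<and>
        (\<forall>q\<in>U. compose M (fst q) (snd q) x \<in> mball (compose M (fst p) (snd p) x) e)"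
      by blast
  qed
  moreover have "continuous_map ?T ?T (\<lambda>f. restrict (inv_into M f) M)"
    unfolding continuous_map_pointwise_topology continuous_map_to_metric
  proof (intro conjI ballI allI impI)
    show "(\<lambda>f. restrict (inv_into M f) M) \<in> topspace ?T \<rightarrow> isometries M d"
      by (auto simp: restrict_inv_isometries)
    fix x f0 and e :: real
    assume x: "x \<in> M" and "f0 \<in> topspace ?T" and e: "0 < e"
    then have f0: "f0 \<in> isometries M d" by simp
    have inv: "inv_into M f x \<in> M \<and> f (inv_into M f x) = x" if "f \<in> isometries M d" for f
      using that x by (auto simp: isometries_def f_inv_into_f inv_into_into)
    define y where "y = inv_into M f0 x"
    have y: "y \<in> M" "f0 y = x" using inv[OF f0] by (auto simp: y_def)
    have "restrict (inv_into M f) M x \<in> mball (restrict (inv_into M f0) M x) e"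
      if f: "f \<in> ?B f0 y e" for f
    proof -
      have f': "f \<in> isometries M d" "d x (f y) < e" using f y by auto
      have "d (f y) (f (inv_into M f x)) = d y (inv_into M f x)"
        using isometries_memD(2)[OF f'(1)] y inv[OF f'(1)] by blast
      then have "d y (inv_into M f x) < e"
        using f'(2) inv[OF f'(1)] by (simp add: commute)
      then show ?thesis using x y inv[OF f'(1)] by (simp add: y_def)
    qed
    moreover have "openin ?T (?B f0 y e)" "f0 \<in> ?B f0 y e"
      using openin_pointwise_ball f0 y e x by auto
    ultimately show "\<exists>U. openin ?T U \<and> f0 \<in> U \<and>
        (\<forall>f\<in>U. restrict (inv_into M f) M x \<in> mball (restrict (inv_into M f0) M x) e)"
      by blast
  qed
  then have "continuous_map ?T ?T (\<lambda>f. inv\<^bsub>Iso M d\<^esub> f)"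
    by (rule continuous_map_eq) (simp add: inv_Iso)
  ultimately show ?thesis
    by unfold_locales (simp_all add: Iso_def case_prod_unfold)
qed

proposition group_action_Iso: "group_action (Iso M d) M (\<lambda>f. f)"
proof -
  have "(\<lambda>f. f) \<in> hom (Iso M d) (BijGroup M)"
    using isometries_subset_Bij by (auto simp: hom_def Iso_def BijGroup_def)
  then show ?thesis
    by (simp add: group_action_def group_hom_def group_hom_axioms_def group_Iso group_BijGroup)
qed

end


section \<open>The metric on the group of bijections of the integers\<close>

text \<open>The enumeration is a bijection \<open>z\<close> from \<open>{1..}\<close> onto the integers; \<open>z 0\<close> plays no role.\<close>

abbreviation IsoZ :: "(int \<Rightarrow> int) set" where
  "IsoZ \<equiv> isometries UNIV discrete_metric.dd"

definition rho :: "(nat \<Rightarrow> int) \<Rightarrow> (int \<Rightarrow> int) \<Rightarrow> (int \<Rightarrow> int) \<Rightarrow> real" where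
  "rho z f g = (\<Sum>i. 1 / 3 ^ Suc i * discrete_metric.dd (f (z (Suc i))) (g (z (Suc i))))"

lemma IsoZ_eq: "IsoZ = {f. bij f}"
  by (auto simp: isometries_def discrete_metric.dd_def bij_def inj_on_def split: if_splits)

lemma summable_rho:
  "summable (\<lambda>i. 1 / 3 ^ Suc i * discrete_metric.dd (f (z (Suc i)) :: int) (g (z (Suc i))))"
proof (rule summable_comparison_test[where g = "\<lambda>i. (1 / 3 :: real) ^ i"])
  show "summable (\<lambda>i. (1 / 3 :: real) ^ i)" by (rule summable_geometric) simp
  show "\<exists>N. \<forall>i\<ge>N. norm (1 / 3 ^ Suc i * discrete_metric.dd (f (z (Suc i))) (g (z (Suc i))))
      \<le> (1 / 3 :: real) ^ i"
    by (auto simp: discrete_metric.dd_def power_one_over field_simps)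
qed

proposition Metric_space_rho:
  assumes z: "bij_betw z {1..} (UNIV :: int set)"
  shows "Metric_space IsoZ (rho z)"
proof
  let ?t = "\<lambda>f g i. 1 / 3 ^ Suc i * discrete_metric.dd (f (z (Suc i)) :: int) (g (z (Suc i)))"
  have t0: "0 \<le> ?t f g i" for f g i by (simp add: discrete_metric.dd_def)
  show "0 \<le> rho z f g" for f g
    unfolding rho_def by (rule suminf_nonneg[OF summable_rho t0])
  show "rho z f g = rho z g f" for f g
    by (simp add: rho_def discrete_metric.dd_def eq_commute)
  show "rho z f g = 0 \<longleftrightarrow> f = g" for f g
  proof
    assume "rho z f g = 0"
    then have "\<forall>i. ?t f g i = 0"
      unfolding rho_def using suminf_eq_zero_iff[OF summable_rho[of f z g] t0[where f = f and g = g]] by blast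
    then have eq: "f (z (Suc i)) = g (z (Suc i))" for i
      by (simp add: discrete_metric.dd_def split: if_splits)
    show "f = g"
    proof
      fix n
      obtain k where "k \<ge> 1" "n = z k"
        using z by (metis atLeast_iff bij_betw_def imageE UNIV_I)
      then show "f n = g n" using eq[of "k - 1"] by simp
    qed
  qed (simp add: rho_def discrete_metric.dd_def)
  show "rho z f h \<le> rho z f g + rho z g h" for f g h
    unfolding rho_def suminf_add[OF summable_rho summable_rho]
    by (intro suminf_le summable_add summable_rho)
      (auto simp: discrete_metric.dd_def field_simps)
qed

end

theory Submission
  imports Defs
begin

text \<open>
  The digits of a ternary expansion with digits in \<open>{0, 1}\<close> are determined by its value, so
  \<open>rho z f g\<close> determines the set of points at which \<open>f\<close> and \<open>g\<close> agree. An isometry \<open>F\<close> of \<open>IsoZ\<close>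
  therefore preserves agreement at each single point, which forces \<open>F f = F id \<circ> f\<close>: the group of
  isometries is the group of bijections of \<open>\<int>\<close> acting by left translations, with the topology of
  pointwise convergence. If \<open>F\<^sub>i y\<close> is a Cauchy net, then \<open>F\<^sub>i id\<close> stabilises at every point of the
  range of \<open>y\<close>, which is \<open>\<int>\<close>, so \<open>F\<^sub>i y'\<close> is Cauchy for all \<open>y'\<close>. In a group with a Weil completion,
  inverting a left Cauchy net gives a left Cauchy net; the cycles \<open>(0 1 \<dots> n)\<close> form a left Cauchy
  sequence whose inverses do not, because they send \<open>0\<close> to \<open>n\<close>.
\<close>

section \<open>Ternary expansions with digits 0 and 1\<close>

lemma summable_ternary_digits:
  fixes a :: "nat \<Rightarrow> real"
  assumes "\<And>i. a i \<in> {0, 1}"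
  shows "summable (\<lambda>i. 1 / 3 ^ Suc i * a i)"
proof (rule summable_comparison_test[where g = "\<lambda>i. (1 / 3 :: real) ^ i"])
  have "norm (1 / 3 ^ Suc i * a i) \<le> (1 / 3) ^ i" for i
    using assms[of i] by (auto simp: power_one_over field_simps)
  then show "\<exists>N. \<forall>i\<ge>N. norm (1 / 3 ^ Suc i * a i) \<le> (1 / 3) ^ i" by blast
qed (simp add: summable_geometric)

text \<open>With digit \<open>k\<close> absent, the tail is at most the geometric series that starts
  with the weight of digit \<open>k + 1\<close>. The bound is half the weight of digit
  \<open>k\<close>; this gap gives uniqueness of digits.\<close>

lemma ternary_tail_le:
  fixes a :: "nat \<Rightarrow> real"
  assumes a: "\<And>i. a i \<in> {0, 1}" and "a k = 0"
  shows "(\<Sum>i. 1 / 3 ^ Suc (i + k) * a (i + k)) \<le> 1 / (2 * 3 ^ Suc k)"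
proof -
  have sg: "(\<lambda>i. (1 / 3 ^ Suc (Suc k)) * (1 / 3 :: real) ^ i) sums ((1 / 3 ^ Suc (Suc k)) * (3 / 2))"
    using geometric_sums[of "1/3 :: real"] by (intro sums_mult) simp
  have s1: "summable (\<lambda>i. 1 / 3 ^ Suc (i + k) * a (i + k))"
    using summable_ignore_initial_segment[OF summable_ternary_digits[of a, OF a], of k] .
  have s2: "summable (\<lambda>i. 1 / 3 ^ Suc (Suc i + k) * a (Suc i + k))"
    using summable_ignore_initial_segment[OF summable_ternary_digits[of a, OF a], of "Suc k"] by simp
  have "(\<Sum>i. 1 / 3 ^ Suc (i + k) * a (i + k)) = (\<Sum>i. 1 / 3 ^ Suc (Suc i + k) * a (Suc i + k))"
    using suminf_split_head[OF s1] assms(2) by simp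
  also have "\<dots> \<le> (\<Sum>i. (1 / 3 ^ Suc (Suc k)) * (1 / 3) ^ i)"
  proof (rule suminf_le[OF _ s2 sums_summable[OF sg]])
    show "1 / 3 ^ Suc (Suc i + k) * a (Suc i + k) \<le> 1 / 3 ^ Suc (Suc k) * (1 / 3) ^ i" for i
      using a[of "Suc i + k"] by (auto simp: power_one_over power_add field_simps)
  qed
  also have "\<dots> = (1 / 3 ^ Suc (Suc k)) * (3 / 2)" using sums_unique[OF sg] by simp
  finally show "(\<Sum>i. 1 / 3 ^ Suc (i + k) * a (i + k)) \<le> 1 / (2 * 3 ^ Suc k)" by simp
qed

text \<open>At the first index where the digits differ, the later digits cannot compensate: the side
  with digit 0 gains at most half the weight of that digit.\<close>

lemma ternary_digits_unique:
  fixes a b :: "nat \<Rightarrow> real"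
  assumes a: "\<And>i. a i \<in> {0, 1}" and b: "\<And>i. b i \<in> {0, 1}"
    and eq: "(\<Sum>i. 1 / 3 ^ Suc i * a i) = (\<Sum>i. 1 / 3 ^ Suc i * b i)"
  shows "a = b"
proof -
  have lt: "(\<Sum>i. 1 / 3 ^ Suc (i + k) * c (i + k)) < (\<Sum>i. 1 / 3 ^ Suc (i + k) * e (i + k))"
    if c: "\<And>i. c i \<in> {0, 1}" and e: "\<And>i. e i \<in> {0, 1}" and k: "c k = 0" "e k = 1"
    for c e :: "nat \<Rightarrow> real" and k
  proof -
    have s: "summable (\<lambda>i. 1 / 3 ^ Suc (i + k) * e (i + k))"
      using summable_ignore_initial_segment[OF summable_ternary_digits[of e, OF e], of k] .
    have "(\<Sum>i. 1 / 3 ^ Suc (i + k) * c (i + k)) \<le> 1 / (2 * 3 ^ Suc k)"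
      by (rule ternary_tail_le[of c, OF c k(1)])
    also have "\<dots> < 1 / 3 ^ Suc k" by (simp add: field_simps)
    also have "\<dots> \<le> (\<Sum>i. 1 / 3 ^ Suc (i + k) * e (i + k))"
    proof -
      have "0 \<le> 1 / 3 ^ Suc (i + k) * e (i + k)" for i using e[of "i + k"] by auto
      then have "sum (\<lambda>i. 1 / 3 ^ Suc (i + k) * e (i + k)) {0} \<le> (\<Sum>i. 1 / 3 ^ Suc (i + k) * e (i + k))"
        by (intro sum_le_suminf s) auto
      then show ?thesis using k by simp
    qed
    finally show ?thesis .
  qed
  have "a k = b k" for k
  proof (induction k rule: less_induct)
    case (less k)
    \<comment> \<open>By the induction hypothesis the initial segments cancel, so the tails from
      \<open>k\<close> are equal, and \<open>lt\<close> excludes different digits at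
      \<open>k\<close> in either order.\<close>
    have "(\<Sum>i. 1 / 3 ^ Suc (i + k) * a (i + k)) = (\<Sum>i. 1 / 3 ^ Suc (i + k) * b (i + k))"
      using suminf_split_initial_segment[OF summable_ternary_digits[of a, OF a], of k]
        suminf_split_initial_segment[OF summable_ternary_digits[of b, OF b], of k] eq less.IH by simp
    then show ?case
      using lt[of a b k, OF a b] lt[of b a k, OF b a] a[of k] b[of k] by fastforce
  qed
  then show ?thesis by blast
qed

section \<open>The metric \<open>rho\<close> and agreement at points\<close>

lemma dd_mem: "discrete_metric.dd x y \<in> {0, 1}"
  by (simp add: discrete_metric.dd_def)

text \<open>The digits of \<open>rho z f g\<close> mark the points where \<open>f\<close> and
  \<open>g\<close> differ, so uniqueness of digits recovers the agreement set from the
  distance.\<close>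

lemma rho_eq_imp_agree_iff:
  assumes z: "bij_betw z {1..} (UNIV :: int set)" and eq: "rho z f g = rho z f' g'"
  shows "f n = g n \<longleftrightarrow> f' n = g' n"
proof -
  have "(\<lambda>i. discrete_metric.dd (f (z (Suc i))) (g (z (Suc i))))
      = (\<lambda>i. discrete_metric.dd (f' (z (Suc i))) (g' (z (Suc i))))"
    using eq unfolding rho_def by (rule ternary_digits_unique[OF dd_mem dd_mem])
  moreover obtain k where "n = z (Suc k)"
    using z by (metis atLeast_iff bij_betw_def imageE UNIV_I Suc_le_D One_nat_def)
  ultimately show ?thesis
    by (metis discrete_metric.dd_def zero_neq_one)
qed

lemma rho_cong_agree:
  assumes "\<And>n. f n = g n \<longleftrightarrow> f' n = g' n"
  shows "rho z f g = rho z f' g'"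
  using assms by (simp add: rho_def discrete_metric.dd_def)

text \<open>A small distance forces agreement at a point because that point alone contributes its
  weight; agreement on a long initial segment leaves only a small tail. An arbitrary filter serves
  both limits of translations and Cauchy nets.\<close>

lemma rho_tendsto_iff:
  assumes z: "bij_betw z {1..} (UNIV :: int set)"
  shows "(\<forall>e>0. \<forall>\<^sub>F p in F. rho z (f p) (g p) < e) \<longleftrightarrow> (\<forall>n. \<forall>\<^sub>F p in F. f p n = g p n)"
proof (intro iffI allI impI)
  fix n assume A: "\<forall>e>0. \<forall>\<^sub>F p in F. rho z (f p) (g p) < e"
  obtain k where k: "n = z (Suc k)"
    using z by (metis atLeast_iff bij_betw_def imageE UNIV_I Suc_le_D One_nat_def)
  have "f p n = g p n" if "rho z (f p) (g p) < 1 / 3 ^ Suc k" for p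
  proof (rule ccontr)
    assume ne: "f p n \<noteq> g p n"
    let ?t = "\<lambda>i. 1 / 3 ^ Suc i * discrete_metric.dd (f p (z (Suc i))) (g p (z (Suc i)))"
    have "sum ?t {k} \<le> suminf ?t"
      by (intro sum_le_suminf summable_rho) (auto simp: discrete_metric.dd_def)
    then show False using that ne k by (simp add: rho_def discrete_metric.dd_def)
  qed
  moreover have "\<forall>\<^sub>F p in F. rho z (f p) (g p) < 1 / 3 ^ Suc k" using A by simp
  ultimately show "\<forall>\<^sub>F p in F. f p n = g p n" by (rule eventually_mono[rotated])
next
  fix e :: real assume A: "\<forall>n. \<forall>\<^sub>F p in F. f p n = g p n" and e: "0 < e"
  obtain k where k: "(1 / 3 :: real) ^ k < e"
    using real_arch_pow_inv[OF e, of "1/3"] by auto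
  \<comment> \<open>The index \<open>k\<close> is included because the tail bound from
    \<open>k\<close> needs digit \<open>k\<close> to be 0.\<close>
  have "\<forall>\<^sub>F p in F. \<forall>i\<in>{..k}. f p (z (Suc i)) = g p (z (Suc i))"
    using A by (intro eventually_ball_finite) auto
  then show "\<forall>\<^sub>F p in F. rho z (f p) (g p) < e"
  proof (rule eventually_mono)
    fix p assume p: "\<forall>i\<in>{..k}. f p (z (Suc i)) = g p (z (Suc i))"
    let ?a = "\<lambda>i. discrete_metric.dd (f p (z (Suc i))) (g p (z (Suc i)))"
    have a0: "?a i = 0" if "i \<le> k" for i using p that by (simp add: discrete_metric.dd_def)
    have "rho z (f p) (g p) = (\<Sum>i. 1 / 3 ^ Suc (i + k) * ?a (i + k))"
      using suminf_split_initial_segment[OF summable_rho[of "f p" z "g p"], of k] a0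
      by (simp add: rho_def)
    also have "\<dots> \<le> 1 / (2 * 3 ^ Suc k)"
      by (rule ternary_tail_le[of ?a, OF dd_mem a0[OF order_refl]])
    also have "\<dots> < (1 / 3) ^ k" by (simp add: power_one_over field_simps)
    finally show "rho z (f p) (g p) < e" using k by simp
  qed
qed

section \<open>Isometries as left translations\<close>

text \<open>Isometries preserve agreement at each point. If \<open>F f n = F id k\<close> with
  \<open>k\<close> different from \<open>f n\<close>, some bijection \<open>g\<close> agrees with
  \<open>f\<close> at \<open>n\<close> and with \<open>id\<close> at \<open>k\<close>, so
  \<open>F g\<close> takes one value at two points.\<close>

lemma isometry_IsoZ_eq:
  assumes z: "bij_betw z {1..} (UNIV :: int set)"
    and F: "F \<in> isometries IsoZ (rho z)" and f: "bij f"
  shows "F f = F id \<circ> f"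
proof
  fix n
  interpret Metric_space IsoZ "rho z" by (rule Metric_space_rho[OF z])
  have agree: "F g k = F h k \<longleftrightarrow> g k = h k" if "bij g" "bij h" for g h k
    using rho_eq_imp_agree_iff[OF z isometries_memD(2)[OF F, of g h]] that by (simp add: IsoZ_eq)
  have bijF: "bij (F g)" if "bij g" for g
    using isometries_memD(1)[OF F, of g] that by (simp add: IsoZ_eq)
  obtain k where k: "F f n = F id k"
    using bijF[OF bij_id] by (metis bij_pointE)
  have "k = f n"
  proof (rule ccontr)
    assume ne: "k \<noteq> f n"
    \<comment> \<open>If \<open>k = n\<close>, then \<open>F f\<close> and \<open>F id\<close> agree
      at \<open>n\<close>, hence \<open>f n = n = k\<close>, against \<open>ne\<close>.\<close>
    have kn: "k \<noteq> n" using agree[OF f bij_id, of n] k ne by auto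
    define g where "g = Transposition.transpose n (f n)"
    have g: "bij g" "g n = f n" "g k = k" using ne kn by (auto simp: g_def)
    have "F g n = F f n" using agree[OF g(1) f] g(2) by simp
    moreover have "F g k = F id k" using agree[OF g(1) bij_id] g(3) by simp
    ultimately show False
      using k kn bijF[OF g(1)] by (metis bij_def injD)
  qed
  then show "F f n = (F id \<circ> f) n" using k by simp
qed

text \<open>The restriction to \<open>IsoZ\<close> makes the map extensional, as membership in
  \<open>isometries\<close> demands.\<close>

definition left_translation :: "(int \<Rightarrow> int) \<Rightarrow> (int \<Rightarrow> int) \<Rightarrow> (int \<Rightarrow> int)" where
  "left_translation \<sigma> = (\<lambda>f\<in>IsoZ. \<sigma> \<circ> f)"

lemma IsoZ_comp: "bij \<sigma> \<Longrightarrow> f \<in> IsoZ \<Longrightarrow> \<sigma> \<circ> f \<in> IsoZ"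
  by (simp add: IsoZ_eq bij_comp)

text \<open>Composing with an injective map on the left does not change where two maps agree, and
  \<open>rho\<close> depends only on that.\<close>

lemma left_translation_isometry:
  assumes s: "bij \<sigma>"
  shows "left_translation \<sigma> \<in> isometries IsoZ (rho z)"
proof -
  have "(\<lambda>f. \<sigma> \<circ> f) ` IsoZ = IsoZ"
  proof (intro equalityI subsetI)
    fix f assume f: "f \<in> IsoZ"
    then have "inv_into UNIV \<sigma> \<circ> f \<in> IsoZ" using s by (auto simp: IsoZ_eq bij_imp_bij_inv intro: bij_comp)
    moreover have "f = \<sigma> \<circ> (inv_into UNIV \<sigma> \<circ> f)"
      using s by (simp add: fun_eq_iff bij_is_surj surj_f_inv_f)
    ultimately show "f \<in> (\<lambda>f. \<sigma> \<circ> f) ` IsoZ" by blast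
  qed (use s in \<open>auto simp: IsoZ_eq intro: bij_comp\<close>)
  moreover have "rho z (\<sigma> \<circ> f) (\<sigma> \<circ> g) = rho z f g" for f g
    using s by (intro rho_cong_agree) (auto dest: bij_is_inj injD)
  ultimately show ?thesis by (simp add: isometries_def left_translation_def)
qed

lemma mult_left_translation:
  assumes "bij \<tau>"
  shows "left_translation \<sigma> \<otimes>\<^bsub>Iso IsoZ d\<^esub> left_translation \<tau> = left_translation (\<sigma> \<circ> \<tau>)"
  using assms
  by (auto simp: Iso_def left_translation_def compose_def IsoZ_eq fun_eq_iff restrict_def bij_comp)

lemma one_left_translation: "\<one>\<^bsub>Iso IsoZ d\<^esub> = left_translation id"
  by (simp add: Iso_def left_translation_def)

lemma inv_left_translation:
  assumes z: "bij_betw z {1..} (UNIV :: int set)" and s: "bij \<sigma>"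
  shows "inv\<^bsub>Iso IsoZ (rho z)\<^esub> left_translation \<sigma> = left_translation (inv_into UNIV \<sigma>)"
proof -
  interpret group "Iso IsoZ (rho z)"
    by (rule Metric_space.group_Iso[OF Metric_space_rho[OF z]])
  have "inv_into UNIV \<sigma> \<circ> \<sigma> = id" using s by (simp add: bij_is_inj)
  then show ?thesis
    using s left_translation_isometry bij_imp_bij_inv[OF s]
    by (intro inv_equality) (simp_all add: mult_left_translation one_left_translation, simp_all add: Iso_def)
qed

text \<open>Convergence is tested at every \<open>f\<close> in \<open>IsoZ\<close>, hence at the
  points \<open>f k\<close>; taking \<open>f = id\<close> already reaches every integer.\<close>

lemma limitin_left_translation_iff:
  assumes z: "bij_betw z {1..} (UNIV :: int set)" and s: "\<And>p. bij (\<sigma> p)" and t: "bij \<tau>"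
  shows "limitin (pointwise_topology IsoZ (rho z)) (\<lambda>p. left_translation (\<sigma> p)) (left_translation \<tau>) F
    \<longleftrightarrow> (\<forall>k. \<forall>\<^sub>F p in F. \<sigma> p k = \<tau> k)"
proof -
  interpret Metric_space IsoZ "rho z" by (rule Metric_space_rho[OF z])
  have lim: "limitin mtopology (\<lambda>p. \<sigma> p \<circ> f) (\<tau> \<circ> f) F \<longleftrightarrow> (\<forall>k. \<forall>\<^sub>F p in F. \<sigma> p (f k) = \<tau> (f k))"
    if "bij f" for f
    using that rho_tendsto_iff[OF z, where F = F and f = "\<lambda>p. \<sigma> p \<circ> f" and g = "\<lambda>p. \<tau> \<circ> f"] s t
    unfolding limitin_metric by (simp add: IsoZ_eq bij_comp)
  have "limitin (pointwise_topology IsoZ (rho z)) (\<lambda>p. left_translation (\<sigma> p)) (left_translation \<tau>) F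
    \<longleftrightarrow> (\<forall>f\<in>IsoZ. limitin mtopology (\<lambda>p. \<sigma> p \<circ> f) (\<tau> \<circ> f) F)"
    using left_translation_isometry[OF s] left_translation_isometry[OF t] s
    by (auto simp: pointwise_topology_def limitin_subtopology limitin_componentwise
        left_translation_def IsoZ_comp)
  also have "\<dots> \<longleftrightarrow> (\<forall>k. \<forall>\<^sub>F p in F. \<sigma> p k = \<tau> k)"
    using lim bij_id by (fastforce simp: IsoZ_eq)
  finally show ?thesis .
qed

section \<open>An obstruction to Weil completions\<close>

text \<open>In the completion the left Cauchy family converges to some \<open>x\<close>, so the
  right quotients tend to \<open>x\<close> times its inverse, which is the identity. The embedding
  carries this limit back to \<open>G\<close>.\<close>

lemma Weil_completion_left_Cauchy_imp_right_Cauchy: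
  fixes G :: "('g, 'b) monoid_scheme" and s :: "'a \<Rightarrow> 'g"
  assumes G: "top_group G T" and W: "has_Weil_completion TYPE('h) G T"
    and F: "F \<noteq> bot" and s: "\<And>a. s a \<in> carrier G"
    and left: "limitin T (\<lambda>(a, b). inv\<^bsub>G\<^esub> s a \<otimes>\<^bsub>G\<^esub> s b) \<one>\<^bsub>G\<^esub> (F \<times>\<^sub>F F)"
  shows "limitin T (\<lambda>(a, b). s a \<otimes>\<^bsub>G\<^esub> inv\<^bsub>G\<^esub> s b) \<one>\<^bsub>G\<^esub> (F \<times>\<^sub>F F)"
proof -
  interpret G: top_group G T by (rule G)
  obtain H :: "'h monoid" and S \<phi> where H: "top_group H S" and complete: "left_complete H S"
    and hom: "\<phi> \<in> hom G H" and emb: "embedding_map T S \<phi>"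
    using W unfolding has_Weil_completion_def by blast
  interpret H: top_group H S by (rule H)
  interpret group_hom G H \<phi> by unfold_locales (rule hom)
  have cont: "continuous_map T S \<phi>"
    using emb homeomorphic_imp_continuous_map by (fastforce simp: embedding_map_def continuous_map_in_subtopology)
  let ?t = "\<lambda>a. \<phi> (s a)"
  have t: "?t a \<in> carrier H" for a using s by simp
  have "limitin S (\<phi> \<circ> (\<lambda>(a, b). inv\<^bsub>G\<^esub> s a \<otimes>\<^bsub>G\<^esub> s b)) (\<phi> \<one>\<^bsub>G\<^esub>) (F \<times>\<^sub>F F)"
    using cont left by (rule continuous_map_limit)
  then have leftH: "limitin S (\<lambda>(a, b). inv\<^bsub>H\<^esub> ?t a \<otimes>\<^bsub>H\<^esub> ?t b) \<one>\<^bsub>H\<^esub> (F \<times>\<^sub>F F)"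
    using s by (simp add: o_def case_prod_unfold)
  \<comment> \<open>Left quotients tending to the identity are exactly what makes the image filter
    Cauchy for the left uniformity.\<close>
  have "filtermap ?t F \<times>\<^sub>F filtermap ?t F \<le> left_uniformity H S"
    unfolding left_uniformity_def
  proof (rule INF_greatest)
    fix U assume "U \<in> {U. openin S U \<and> \<one>\<^bsub>H\<^esub> \<in> U}"
    then have "\<forall>\<^sub>F p in F \<times>\<^sub>F F. (\<lambda>(a, b). inv\<^bsub>H\<^esub> ?t a \<otimes>\<^bsub>H\<^esub> ?t b) p \<in> U"
      using leftH by (auto simp: limitin_def)
    then show "filtermap ?t F \<times>\<^sub>F filtermap ?t F
        \<le> principal {(x, y). x \<in> carrier H \<and> y \<in> carrier H \<and> inv\<^bsub>H\<^esub> x \<otimes>\<^bsub>H\<^esub> y \<in> U}"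
      using t by (simp add: le_principal prod_filtermap1 prod_filtermap2 eventually_filtermap
          case_prod_unfold)
  qed
  moreover have "filtermap ?t F \<noteq> bot" using F by (simp add: filtermap_bot_iff)
  moreover have "filtermap ?t F \<le> principal (carrier H)"
    using t by (simp add: le_principal eventually_filtermap)
  ultimately obtain x where x: "x \<in> carrier H" "limitin S (\<lambda>y. y) x (filtermap ?t F)"
    using complete unfolding left_complete_def by blast
  have lim: "limitin S ?t x F"
    using x(2) by (simp add: limitin_def eventually_filtermap)
  have lim1: "limitin S (\<lambda>p. ?t (fst p)) x (F \<times>\<^sub>F F)"
    using lim by (auto simp: limitin_def intro: eventually_compose_filterlim[OF _ filterlim_fst])
  have lim2: "limitin S (\<lambda>p. inv\<^bsub>H\<^esub> ?t (snd p)) (inv\<^bsub>H\<^esub> x) (F \<times>\<^sub>F F)"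
  proof -
    have "limitin S (\<lambda>p. ?t (snd p)) x (F \<times>\<^sub>F F)"
      using lim by (auto simp: limitin_def intro: eventually_compose_filterlim[OF _ filterlim_snd])
    then show ?thesis
      using continuous_map_limit[OF H.continuous_inv] by (fastforce simp: o_def)
  qed
  have "limitin (prod_topology S S) (\<lambda>p. (?t (fst p), inv\<^bsub>H\<^esub> ?t (snd p))) (x, inv\<^bsub>H\<^esub> x) (F \<times>\<^sub>F F)"
    using lim1 lim2 by (simp add: limitin_pairwise o_def)
  from continuous_map_limit[OF H.continuous_mult this]
  have rightH: "limitin S (\<lambda>(a, b). \<phi> (s a \<otimes>\<^bsub>G\<^esub> inv\<^bsub>G\<^esub> s b)) \<one>\<^bsub>H\<^esub> (F \<times>\<^sub>F F)"
    using x(1) s by (simp add: o_def case_prod_unfold)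
  show ?thesis
    unfolding limitin_def
  proof (intro conjI allI impI)
    show "\<one>\<^bsub>G\<^esub> \<in> topspace T" by (simp add: G.topspace_eq)
    fix U assume U: "openin T U \<and> \<one>\<^bsub>G\<^esub> \<in> U"
    have US: "U \<subseteq> carrier G" using U openin_subset G.topspace_eq by blast
    have inj: "inj_on \<phi> (carrier G)"
      using emb homeomorphic_imp_injective_map by (fastforce simp: embedding_map_def G.topspace_eq)
    \<comment> \<open>A neighbourhood in \<open>G\<close> is the trace of an open set
      \<open>V\<close> of \<open>H\<close> on the image, so the limit in \<open>H\<close> can be
      tested on \<open>V\<close>.\<close>
    have "openin (subtopology S (\<phi> ` topspace T)) (\<phi> ` U)"
      using emb U homeomorphic_imp_open_map by (fastforce simp: embedding_map_def open_map_def)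
    then obtain V where V: "openin S V" "\<phi> ` U = V \<inter> \<phi> ` carrier G"
      by (auto simp: openin_subtopology G.topspace_eq)
    have "\<one>\<^bsub>H\<^esub> \<in> V" using U V(2) hom_one by (metis IntD1 imageI)
    then have "\<forall>\<^sub>F p in F \<times>\<^sub>F F. (\<lambda>(a, b). \<phi> (s a \<otimes>\<^bsub>G\<^esub> inv\<^bsub>G\<^esub> s b)) p \<in> V"
      using rightH V(1) by (auto simp: limitin_def)
    then show "\<forall>\<^sub>F p in F \<times>\<^sub>F F. (\<lambda>(a, b). s a \<otimes>\<^bsub>G\<^esub> inv\<^bsub>G\<^esub> s b) p \<in> U"
    proof (rule eventually_mono)
      fix p assume p: "(\<lambda>(a, b). \<phi> (s a \<otimes>\<^bsub>G\<^esub> inv\<^bsub>G\<^esub> s b)) p \<in> V"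
      obtain a b where ab: "p = (a, b)" by fastforce
      let ?w = "s a \<otimes>\<^bsub>G\<^esub> inv\<^bsub>G\<^esub> s b"
      have w: "?w \<in> carrier G" using s by simp
      then have "\<phi> ?w \<in> \<phi> ` U" using V(2) p ab by auto
      then show "(\<lambda>(a, b). s a \<otimes>\<^bsub>G\<^esub> inv\<^bsub>G\<^esub> s b) p \<in> U"
        using inj_on_image_mem_iff[OF inj w US] ab by simp
    qed
  qed
qed

section \<open>The cycles that rule out a Weil completion\<close>

text \<open>The cycle \<open>(0 1 ... n)\<close>. As \<open>n\<close> grows it stabilises pointwise
  to the successor on nonnegative integers and the identity elsewhere, an injection that misses
  0.\<close>

definition initial_cycle :: "nat \<Rightarrow> int \<Rightarrow> int" where
  "initial_cycle n k = (if 0 \<le> k \<and> k < int n then k + 1 else if k = int n then 0 else k)"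

definition initial_cycle_inv :: "nat \<Rightarrow> int \<Rightarrow> int" where
  "initial_cycle_inv n k = (if 0 < k \<and> k \<le> int n then k - 1 else if k = 0 then int n else k)"

lemma bij_initial_cycle: "bij (initial_cycle n)"
  and inv_initial_cycle: "inv_into UNIV (initial_cycle n) = initial_cycle_inv n"
proof -
  have 1: "initial_cycle_inv n \<circ> initial_cycle n = id" "initial_cycle n \<circ> initial_cycle_inv n = id"
    by (auto simp: fun_eq_iff initial_cycle_def initial_cycle_inv_def)
  then show "bij (initial_cycle n)" by (rule o_bij)
  show "inv_into UNIV (initial_cycle n) = initial_cycle_inv n"
    using inv_unique_comp[OF 1(2) 1(1)] .
qed

lemma no_Weil_completion_IsoIsoZ:
  assumes z: "bij_betw z {1..} (UNIV :: int set)"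
  shows "\<not> has_Weil_completion TYPE('h) (Iso IsoZ (rho z)) (pointwise_topology IsoZ (rho z))"
proof
  let ?G = "Iso IsoZ (rho z)" and ?T = "pointwise_topology IsoZ (rho z)"
  let ?s = "\<lambda>n. left_translation (initial_cycle n)"
  assume W: "has_Weil_completion TYPE('h) ?G ?T"
  have G: "top_group ?G ?T" by (rule Metric_space.top_group_Iso[OF Metric_space_rho[OF z]])
  note bij = bij_initial_cycle bij_imp_bij_inv[OF bij_initial_cycle, unfolded inv_initial_cycle]
  have s: "?s n \<in> carrier ?G" for n
    using left_translation_isometry[OF bij_initial_cycle] by (simp add: Iso_def)
  have eq: "(\<lambda>(m, n). inv\<^bsub>?G\<^esub> ?s m \<otimes>\<^bsub>?G\<^esub> ?s n)
      = (\<lambda>p. left_translation (initial_cycle_inv (fst p) \<circ> initial_cycle (snd p)))"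
    "(\<lambda>(m, n). ?s m \<otimes>\<^bsub>?G\<^esub> inv\<^bsub>?G\<^esub> ?s n)
      = (\<lambda>p. left_translation (initial_cycle (fst p) \<circ> initial_cycle_inv (snd p)))"
    by (auto simp: inv_left_translation[OF z] bij inv_initial_cycle mult_left_translation)
  have "limitin ?T (\<lambda>(m, n). inv\<^bsub>?G\<^esub> ?s m \<otimes>\<^bsub>?G\<^esub> ?s n) \<one>\<^bsub>?G\<^esub> (sequentially \<times>\<^sub>F sequentially)"
    unfolding eq one_left_translation
  proof (subst limitin_left_translation_iff[OF z], goal_cases)
    case 3
    show ?case
    proof
      fix k
      show "\<forall>\<^sub>F p in sequentially \<times>\<^sub>F sequentially.
          (initial_cycle_inv (fst p) \<circ> initial_cycle (snd p)) k = id k"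
        unfolding eventually_prod_sequentially
        \<comment> \<open>For \<open>k\<close> at least 0, indices from \<open>k + 1\<close> on make
          the cycle send \<open>k\<close> to \<open>k + 1\<close> and the inverse cycle send it
          back. Negative \<open>k\<close> are fixed throughout.\<close>
        by (intro exI[of _ "Suc (nat k)"]) (auto simp: initial_cycle_def initial_cycle_inv_def)
    qed
  qed (auto intro: bij_comp bij)
  then have "limitin ?T (\<lambda>(m, n). ?s m \<otimes>\<^bsub>?G\<^esub> inv\<^bsub>?G\<^esub> ?s n) \<one>\<^bsub>?G\<^esub> (sequentially \<times>\<^sub>F sequentially)"
    by (rule Weil_completion_left_Cauchy_imp_right_Cauchy[OF G W sequentially_bot s])
  then have "\<forall>k. \<forall>\<^sub>F p in sequentially \<times>\<^sub>F sequentially.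
      (initial_cycle (fst p) \<circ> initial_cycle_inv (snd p)) k = id k"
    unfolding eq one_left_translation
    by (subst (asm) limitin_left_translation_iff[OF z]) (auto intro: bij_comp bij)
  then have "\<exists>N. \<forall>m\<ge>N. \<forall>n\<ge>N. (initial_cycle n \<circ> initial_cycle_inv m) 0 = id 0"
    unfolding eventually_prod_sequentially fst_conv snd_conv by (rule spec)
  then obtain N where
    N: "\<forall>m\<ge>N. \<forall>n\<ge>N. (initial_cycle n \<circ> initial_cycle_inv m) 0 = id 0" by (rule exE)
  then show False
    \<comment> \<open>The inverse cycle of index \<open>N\<close> sends 0 to \<open>N\<close>, and
      the cycle of index \<open>N + 1\<close> sends \<open>N\<close> to \<open>N + 1\<close>, which
      is not 0.\<close>
    using N[rule_format, of N "Suc N"] by (simp add: initial_cycle_def initial_cycle_inv_def)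
qed

section \<open>Cauchy nets and indivisibility\<close>

text \<open>Pairs of late indices generate a filter \<open>F\<close>, with base sets
  \<open>B i0\<close> by directedness. Being Cauchy is a statement about \<open>F\<close>, so the
  filter criterion for \<open>rho\<close> applies.\<close>

lemma cauchy_net_rho_iff:
  assumes z: "bij_betw z {1..} (UNIV :: int set)" and I: "directed_set I leI"
  shows "cauchy_net (rho z) I leI u \<longleftrightarrow>
    (\<forall>n. \<exists>i0\<in>I. \<forall>i\<in>I. \<forall>j\<in>I. leI i0 i \<longrightarrow> leI i0 j \<longrightarrow> u i n = u j n)"
proof -
  define B where "B = (\<lambda>i0. {(i, j). i \<in> I \<and> j \<in> I \<and> leI i0 i \<and> leI i0 j})"
  define F where "F = (INF i0\<in>I. principal (B i0))"
  have ev: "eventually P F \<longleftrightarrow> (\<exists>i0\<in>I. \<forall>i\<in>I. \<forall>j\<in>I. leI i0 i \<longrightarrow> leI i0 j \<longrightarrow> P (i, j))" for P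
    unfolding F_def
  proof (subst eventually_INF_base)
    show "I \<noteq> {}" using I by (simp add: directed_set_def)
    fix a b assume ab: "a \<in> I" "b \<in> I"
    then obtain c where c: "c \<in> I" "leI a c" "leI b c"
      using I unfolding directed_set_def by blast
    moreover have "B c \<subseteq> B a \<inter> B b"
      using I ab c unfolding directed_set_def B_def by blast
    ultimately show "\<exists>x\<in>I. principal (B x) \<le> inf (principal (B a)) (principal (B b))" by auto
  qed (auto simp: B_def eventually_principal)
  show ?thesis
    using rho_tendsto_iff[OF z, where F = F and f = "\<lambda>p. u (fst p)" and g = "\<lambda>p. u (snd p)"]
    by (simp add: ev cauchy_net_def)
qed

text \<open>Since \<open>g i y\<close> is \<open>g i id\<close> after \<open>y\<close>, the value of
  \<open>g i y'\<close> at \<open>n\<close> is that of \<open>g i y\<close> at the preimage of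
  \<open>y' n\<close> under \<open>y\<close>, a point independent of \<open>i\<close>.\<close>

lemma cauchy_net_isometries_transfer:
  assumes z: "bij_betw z {1..} (UNIV :: int set)" and I: "directed_set I leI"
    and g: "g \<in> I \<rightarrow> carrier (Iso IsoZ (rho z))" and y: "y \<in> IsoZ" and y': "y' \<in> IsoZ"
    and C: "cauchy_net (rho z) I leI (\<lambda>i. g i y)"
  shows "cauchy_net (rho z) I leI (\<lambda>i. g i y')"
proof -
  have bij: "bij y" "bij y'" using y y' by (simp_all add: IsoZ_eq)
  have g_eq: "g i f n = g i id (f n)" if "i \<in> I" "bij f" for i f n
  proof -
    have "g i \<in> isometries IsoZ (rho z)" using funcset_mem[OF g that(1)] by (simp add: Iso_def)
    from fun_cong[OF isometry_IsoZ_eq[OF z this that(2)], of n] show ?thesis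
      unfolding o_apply .
  qed
  have eq: "g i y' n = g i y (inv_into UNIV y (y' n))" if "i \<in> I" for i n
  proof -
    have "y (inv_into UNIV y (y' n)) = y' n"
      using bij(1) by (simp add: bij_is_surj surj_f_inv_f)
    then show ?thesis unfolding g_eq[OF that bij(1)] g_eq[OF that bij(2)] by (simp only:)
  qed
  show "cauchy_net (rho z) I leI (\<lambda>i. g i y')"
    unfolding cauchy_net_rho_iff[OF z I]
  proof
    fix n
    obtain i0 where "i0 \<in> I" "\<forall>i\<in>I. \<forall>j\<in>I. leI i0 i \<longrightarrow> leI i0 j \<longrightarrow>
        g i y (inv_into UNIV y (y' n)) = g j y (inv_into UNIV y (y' n))"
      using C unfolding cauchy_net_rho_iff[OF z I] by blast
    then show "\<exists>i0\<in>I. \<forall>i\<in>I. \<forall>j\<in>I. leI i0 i \<longrightarrow> leI i0 j \<longrightarrow> g i y' n = g j y' n"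
      using eq by metis
  qed
qed

lemma Cauchy_indivisible_IsoIsoZ:
  assumes z: "bij_betw z {1..} (UNIV :: int set)"
  shows "Cauchy_indivisible TYPE('i) (Iso IsoZ (rho z)) (pointwise_topology IsoZ (rho z))
           (\<lambda>g y. g y) IsoZ (rho z)"
  unfolding Cauchy_indivisible_def
proof (intro allI impI)
  fix I :: "'i set" and leI g
  assume I: "directed_set I leI" and g: "g \<in> I \<rightarrow> carrier (Iso IsoZ (rho z))"
    and ex: "\<exists>y\<in>IsoZ. cauchy_net (rho z) I leI (\<lambda>i. g i y)"
  obtain y where y: "y \<in> IsoZ" and C: "cauchy_net (rho z) I leI (\<lambda>i. g i y)"
    using ex by (rule bexE)
  show "\<forall>y\<in>IsoZ. cauchy_net (rho z) I leI (\<lambda>i. g i y)"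
  proof
    show "cauchy_net (rho z) I leI (\<lambda>i. g i y')" if "y' \<in> IsoZ" for y'
      using cauchy_net_isometries_transfer[where g = g, OF z I g y that C] .
  qed
qed

theorem proposition6p5:
  fixes z :: "nat \<Rightarrow> int"
  assumes "bij_betw z {1..} (UNIV :: int set)"
  shows "Cauchy_indivisible TYPE('i) (Iso IsoZ (rho z)) (pointwise_topology IsoZ (rho z))
           (\<lambda>g y. g y) IsoZ (rho z) \<and>
         \<not> has_Weil_completion TYPE('h) (Iso IsoZ (rho z)) (pointwise_topology IsoZ (rho z))"
  using Cauchy_indivisible_IsoIsoZ[OF assms] no_Weil_completion_IsoIsoZ[OF assms] by blast

end
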